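(* Let $n$ be an integer, $m\ge 1$ and $1\le d\le m+1$. Let $p,q,r,a,b,c$ be real numbers with $c\neq 0$, let $(P_n)_{n\in\mathbb{Z}}=\mathcal{P}(x)(p,q,r;a,b,c)$, $(U_n)_{n\in\mathbb{Z}}=\mathcal{P}(x)(0,0,1;a,b,c)$, and $\Delta_{\mathcal{P}}=(q^2-apq)x^2+(2qr-apr-bpq)x+(r^2-bpr-cp^2)$. Then \[ \det\big([P_{n+i+j}^{\langle m\rangle}]_{0\le i,j\le d-1}\big) = (-1)^{n\binom{d}{2}+\binom{d+1}{3}}\,c^{(n+d-2)\binom{d}{2}}\,\Delta_{\mathcal{P}}^{\binom{d}{2}}\prod_{i=1}^{d-1}\big(U_iU_{m+1-i}\big)^{d-i}\cdot\prod_{i=d-1}^{2(d-1)}P_{n+i}^{\langle m+1-d\rangle}. \]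
   Context: For real numbers $p,q,r,a,b,c$ with $c\neq 0$, $\mathcal{P}(x)(p,q,r;a,b,c)=(P_n)_{n\in\mathbb{Z}}$ denotes the sequence of polynomials in $x$ defined by $P_0=p$, $P_1=qx+r$, $P_{n+2}=(ax+b)P_{n+1}+cP_n$ for $n\ge 0$, and for $n<0$ by $P_n=-\frac{ax+b}{c}P_{n+1}+\frac{1}{c}P_{n+2}$; so $U_0=0$, $U_1=1$. Rising powers: $P_n^{\langle t\rangle}=P_nP_{n+1}\cdots P_{n+t-1}$ for $t\ge 1$, and $P_n^{\langle 0\rangle}=1$. $[M_{i,j}]_{0\le i,j\le d-1}$ is the $d\times d$ matrix with entry $M_{i,j}$ in row $i$, column $j$. *)

theory Defs
  imports "Jordan_Normal_Form.Determinant"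
begin

text \<open>The sequence $\mathcal{P}(x)(p,q,r;a,b,c)$; it is only used for \<open>c \<noteq> 0\<close>.\<close>

function poly_seq ::
  "real \<Rightarrow> real \<Rightarrow> real \<Rightarrow> real \<Rightarrow> real \<Rightarrow> real \<Rightarrow> int \<Rightarrow> real poly"
where
  "poly_seq p q r a b c n =
     (if n = 0 then [:p:]
      else if n = 1 then [:r, q:]
      else if n \<ge> 2 then
        [:b, a:] * poly_seq p q r a b c (n - 1) + smult c (poly_seq p q r a b c (n - 2))
      else
        - (smult (1 / c) [:b, a:] * poly_seq p q r a b c (n + 1))
        + smult (1 / c) (poly_seq p q r a b c (n + 2)))"
  by pat_completeness auto
termination
  by (relation "measure (\<lambda>(p, q, r, a, b, c, n). nat (if n < 0 then 2 - n else n))") auto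

declare poly_seq.simps [simp del]

definition rising_power :: "(int \<Rightarrow> real poly) \<Rightarrow> int \<Rightarrow> nat \<Rightarrow> real poly" where
  "rising_power P n t = (\<Prod>k<t. P (n + int k))"

definition Delta :: "real \<Rightarrow> real \<Rightarrow> real \<Rightarrow> real \<Rightarrow> real \<Rightarrow> real \<Rightarrow> real poly" where
  "Delta p q r a b c =
     [: r\<^sup>2 - b * p * r - c * p\<^sup>2, 2 * q * r - a * p * r - b * p * q, q\<^sup>2 - a * p * q :]"

end

theory Submission
  imports Defs
begin

text \<open>
  Row \<open>i\<close> of the matrix has the common factor $P_{n+i+d-1}^{\langle m+1-d\rangle}$. By
  $P_{k+s} = c\,U_{s-1} P_k + U_s P_{k+1}$, what is left in column \<open>j\<close> is the product
  $B_0 \cdots B_{j-1} A_j \cdots A_{d-2}$ of linear forms $A_s = P_{n+i+s}$, $B_s = P_{n+i+m+s}$ in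
  $(X_i, Y_i) = (P_{n+i}, P_{n+i+1})$, whose coefficients do not depend on \<open>i\<close>. Such a determinant is
  the product of all $X_i Y_k - X_k Y_i$ with $i < k$ and of all $2 \times 2$ coefficient determinants
  of $A_t, B_s$ with $s \le t$ (a homogeneous version of a lemma of Krattenthaler). By the Cassini and
  d'Ocagne identities these are $-(-c)^{n+i} U_{k-i} \Delta_{\mathcal{P}}$ and $(-c)^t U_{m+s-t}$.
\<close>

section \<open>Determinants of products of binary linear forms\<close>

lemma det_scale_rows_cols:
  fixes M :: "nat \<Rightarrow> nat \<Rightarrow> 'a :: comm_ring_1"
  shows "det (mat n n (\<lambda>(i, j). f i * g j * M i j)) =
    (\<Prod>i<n. f i) * (\<Prod>j<n. g j) * det (mat n n (\<lambda>(i, j). M i j))"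
proof -
  have "(\<Prod>i = 0..<n. mat n n (\<lambda>(i, j). f i * g j * M i j) $$ (i, \<pi> i)) =
      (\<Prod>i<n. f i) * (\<Prod>j<n. g j) * (\<Prod>i = 0..<n. mat n n (\<lambda>(i, j). M i j) $$ (i, \<pi> i))"
    if \<pi>: "\<pi> permutes {0..<n}" for \<pi>
  proof -
    have lt: "\<pi> i < n" if "i < n" for i
      using permutes_in_image[OF \<pi>, of i] that by simp
    have "(\<Prod>i = 0..<n. mat n n (\<lambda>(i, j). f i * g j * M i j) $$ (i, \<pi> i)) =
        (\<Prod>i = 0..<n. f i * g (\<pi> i) * M i (\<pi> i))"
      using lt by (intro prod.cong) auto
    also have "\<dots> = (\<Prod>i = 0..<n. f i) * (\<Prod>i = 0..<n. g (\<pi> i)) * (\<Prod>i = 0..<n. M i (\<pi> i))"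
      by (simp add: prod.distrib)
    also have "(\<Prod>i = 0..<n. g (\<pi> i)) = (\<Prod>j = 0..<n. g j)"
      using prod.permute[OF \<pi>, of g] by (simp add: o_def)
    also have "(\<Prod>i = 0..<n. M i (\<pi> i)) = (\<Prod>i = 0..<n. mat n n (\<lambda>(i, j). M i j) $$ (i, \<pi> i))"
      using lt by (intro prod.cong) auto
    finally show ?thesis
      by (simp add: atLeast0LessThan)
  qed
  then show ?thesis
    by (simp add: det_def'[of _ n] sum_distrib_left mult.left_commute)
qed

lemma det_last_row_single:
  fixes R :: "'a :: comm_ring_1 mat"
  assumes R: "R \<in> carrier_mat (Suc n) (Suc n)"
    and zero: "\<And>j. j < n \<Longrightarrow> R $$ (n, j) = 0"
  shows "det R = R $$ (n, n) * det (mat n n (\<lambda>(i, j). R $$ (i, j)))"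
proof -
  have "mat_delete R n n = mat n n (\<lambda>(i, j). R $$ (i, j))"
    using R by (intro eq_matI) (auto simp: mat_delete_def)
  then show ?thesis
    using laplace_expansion_row[OF R, of n] zero by (simp add: cofactor_def)
qed

text \<open>
  Induction on the size: combining each column with its right neighbour annihilates the last row
  except for its last entry, and turns the remaining block into the matrix of size one less with
  \<open>a\<close>, \<open>a'\<close> shifted by one. The column operations scale the determinant by the factors
  \<open>b s * X N + b' s * Y N\<close>, which therefore have to be cancelled.
\<close>

lemma det_linear_forms_generic:
  fixes X Y a a' b b' :: "nat \<Rightarrow> 'a :: idom"
  assumes "\<And>s i. s < N \<Longrightarrow> i \<le> N \<Longrightarrow> b s * X i + b' s * Y i \<noteq> 0"
  shows "det (mat (Suc N) (Suc N) (\<lambda>(i, j).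
      (\<Prod>s<j. b s * X i + b' s * Y i) * (\<Prod>s = j..<N. a s * X i + a' s * Y i))) =
    (\<Prod>k<Suc N. \<Prod>i<k. X i * Y k - X k * Y i) *
    (\<Prod>t<N. \<Prod>s\<le>t. a t * b' s - a' t * b s)"
  using assms
proof (induction N arbitrary: a a')
  case 0
  show ?case by (subst det_single) auto
next
  case (Suc N)
  define A where "A s i = a s * X i + a' s * Y i" for s i
  define B where "B s i = b s * X i + b' s * Y i" for s i
  define F where "F i j = (\<Prod>s<j. B s i) * (\<Prod>s = j..<Suc N. A s i)" for i j
  define G where "G i j = (\<Prod>s<j. B s i) * (\<Prod>s = j..<N. A (Suc s) i)" for i j
  define w where "w = Suc N"
  define M where "M = mat (Suc w) (Suc w) (\<lambda>(i, j). F i j)"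
  \<comment> \<open>Lower bidiagonal: for \<open>j < w\<close>, column \<open>j\<close> of
    \<open>M * T\<close> is \<open>B j w\<close> times column \<open>j\<close> of \<open>M\<close>
    minus \<open>A j w\<close> times the next one, with weights chosen to kill row \<open>w\<close>;
    column \<open>w\<close> is kept.\<close>
  define T where "T = mat (Suc w) (Suc w) (\<lambda>(k, j).
    if k = j then if j = w then 1 else B j w
    else if k = Suc j then - A j w else 0)"
  have carrier: "M \<in> carrier_mat (Suc w) (Suc w)" "T \<in> carrier_mat (Suc w) (Suc w)"
    by (auto simp: M_def T_def)
  have "det T = prod_list (diag_mat T)"
    using carrier(2) by (intro det_lower_triangular[of "Suc w"]) (auto simp: T_def)
  also have "diag_mat T = map (\<lambda>j. if j = w then 1 else B j w) [0..<Suc w]"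
    by (auto simp: diag_mat_def T_def)
  also have "prod_list \<dots> = (\<Prod>j<w. B j w)"
    by (simp add: prod.distinct_set_conv_list[symmetric] atLeast0LessThan
        cong: prod.cong_simp)
  finally have det_T: "det T = (\<Prod>j<w. B j w)" .
  have entry_last: "(M * T) $$ (i, w) = F i w" if "i \<le> w" for i
  proof -
    have "(M * T) $$ (i, w) = (\<Sum>k = 0..<Suc w. F i k * (if k = w then 1 else 0))"
      using that carrier by (auto simp: scalar_prod_def M_def T_def intro!: sum.cong)
    then show ?thesis by (simp add: if_distrib cong: if_cong)
  qed
  have entry: "(M * T) $$ (i, j) =
      (X i * Y w - X w * Y i) * (a j * b' j - a' j * b j) * G i j"
    if "i \<le> w" "j < w" for i j
  proof -
    have "(M * T) $$ (i, j) = (\<Sum>k = 0..<Suc w. F i k * (if k = j then B j w else if k = Suc j then - A j w else 0))"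
      using that carrier by (auto simp: scalar_prod_def M_def T_def intro!: sum.cong)
    also have "\<dots> = (\<Sum>k\<in>{j, Suc j}. F i k * (if k = j then B j w else if k = Suc j then - A j w else 0))"
      using that by (intro sum.mono_neutral_right) auto
    also have "\<dots> = F i j * B j w - F i (Suc j) * A j w"
      by simp
    also have "F i j = G i j * A j i"
    proof -
      have "(\<Prod>s = j..<Suc N. A s i) = A j i * (\<Prod>s = Suc j..<Suc N. A s i)"
        using that by (intro prod.atLeast_Suc_lessThan) (simp add: w_def)
      then show ?thesis
        unfolding F_def G_def prod.shift_bounds_Suc_ivl by simp
    qed
    also have "F i (Suc j) = G i j * B j i"
      unfolding F_def G_def prod.shift_bounds_Suc_ivl by simp
    \<comment> \<open>The bracket \<open>A j i * B j w - B j i * A j w\<close> is the determinant of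
      a product of two 2 x 2 matrices, one of coefficients and one of the points \<open>i\<close>,
      \<open>w\<close>; it vanishes for \<open>i = w\<close>.\<close>
    finally show ?thesis
      by (simp add: A_def B_def algebra_simps)
  qed
  have "det M * det T = det (M * T)"
    using det_mult[OF carrier] by simp
  also have "\<dots> = F w w * det (mat w w (\<lambda>(i, j). (M * T) $$ (i, j)))"
    using det_last_row_single[of "M * T" w] carrier entry[of w] entry_last[of w] by simp
  also have "mat w w (\<lambda>(i, j). (M * T) $$ (i, j)) =
      mat w w (\<lambda>(i, j). (X i * Y w - X w * Y i) * (a j * b' j - a' j * b j) * G i j)"
    by (intro eq_matI) (auto simp: entry simp del: index_mult_mat)
  also have "det \<dots> = (\<Prod>i<w. X i * Y w - X w * Y i) * (\<Prod>j<w. a j * b' j - a' j * b j) *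
      det (mat w w (\<lambda>(i, j). G i j))"
    by (rule det_scale_rows_cols)
  also have "det (mat w w (\<lambda>(i, j). G i j)) =
      (\<Prod>k<w. \<Prod>i<k. X i * Y k - X k * Y i) *
      (\<Prod>t<N. \<Prod>s\<le>t. a (Suc t) * b' s - a' (Suc t) * b s)"
    unfolding G_def w_def A_def B_def
    by (rule Suc.IH) (use Suc.prems in auto)
  also have "F w w = (\<Prod>j<w. B j w)"
    by (simp add: F_def w_def)
  finally have eq: "(\<Prod>j<w. B j w) * det M = (\<Prod>j<w. B j w) *
      ((\<Prod>k<Suc w. \<Prod>i<k. X i * Y k - X k * Y i) *
       ((\<Prod>t<w. a t * b' t - a' t * b t) *
        (\<Prod>t<N. \<Prod>s\<le>t. a (Suc t) * b' s - a' (Suc t) * b s)))"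
    by (simp add: det_T mult_ac)
  have "(\<Prod>j<w. B j w) \<noteq> 0"
    using Suc.prems by (auto simp: B_def w_def)
  with eq have "det M = (\<Prod>k<Suc w. \<Prod>i<k. X i * Y k - X k * Y i) *
       ((\<Prod>t<w. a t * b' t - a' t * b t) *
        (\<Prod>t<N. \<Prod>s\<le>t. a (Suc t) * b' s - a' (Suc t) * b s))"
    by simp
  \<comment> \<open>The column operations supply the diagonal \<open>s = t\<close>, the shifted
    induction hypothesis the pairs \<open>s < t\<close>.\<close>
  also have "(\<Prod>t<w. a t * b' t - a' t * b t) *
        (\<Prod>t<N. \<Prod>s\<le>t. a (Suc t) * b' s - a' (Suc t) * b s) =
      (\<Prod>t<w. \<Prod>s\<le>t. a t * b' s - a' t * b s)"
    by (simp add: w_def prod.lessThan_Suc_shift prod.distrib mult_ac del: prod.lessThan_Suc)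
  finally show ?case
    by (simp add: M_def F_def A_def B_def w_def)
qed

lemma det_linear_forms:
  fixes X Y a a' b b' :: "nat \<Rightarrow> 'a :: idom"
  shows "det (mat (Suc N) (Suc N) (\<lambda>(i, j).
      (\<Prod>s<j. b s * X i + b' s * Y i) * (\<Prod>s = j..<N. a s * X i + a' s * Y i))) =
    (\<Prod>k<Suc N. \<Prod>i<k. X i * Y k - X k * Y i) *
    (\<Prod>t<N. \<Prod>s\<le>t. a t * b' s - a' t * b s)" (is "det ?M = ?rhs")
proof -
  \<comment> \<open>Perturbing \<open>b\<close> and \<open>X\<close> by an indeterminate makes every form \<open>b s * X i + b' s * Y i\<close> a monic
    quadratic, hence nonzero; afterwards the indeterminate is set to 0.\<close>
  interpret ev: comm_ring_hom "\<lambda>p :: 'a poly. poly p 0"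
    by standard auto
  let ?X = "\<lambda>i. [:X i, 1:]" and ?Y = "\<lambda>i. [:Y i:]"
    and ?a = "\<lambda>s. [:a s:]" and ?a' = "\<lambda>s. [:a' s:]"
    and ?b = "\<lambda>s. [:b s, 1:]" and ?b' = "\<lambda>s. [:b' s:]"
  let ?L = "mat (Suc N) (Suc N) (\<lambda>(i, j).
      (\<Prod>s<j. ?b s * ?X i + ?b' s * ?Y i) * (\<Prod>s = j..<N. ?a s * ?X i + ?a' s * ?Y i))"
  have "?M = map_mat (\<lambda>p. poly p 0) ?L"
    by (intro eq_matI) (auto simp: poly_prod mult.commute)
  then have "det ?M = poly (det ?L) 0"
    by (simp only: ev.hom_det)
  also have "det ?L = (\<Prod>k<Suc N. \<Prod>i<k. ?X i * ?Y k - ?X k * ?Y i) *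
    (\<Prod>t<N. \<Prod>s\<le>t. ?a t * ?b' s - ?a' t * ?b s)"
    by (rule det_linear_forms_generic) simp
  also have "poly \<dots> 0 = ?rhs"
    by (simp add: poly_prod mult_ac)
  finally show ?thesis .
qed

section \<open>Second-order recurrences on the integers\<close>

locale recurrence_pair =
  fixes P U :: "int \<Rightarrow> 'a :: comm_ring_1" and A C :: 'a
  assumes P_rec: "P (k + 2) = A * P (k + 1) + C * P k"
    and U_rec: "U (k + 2) = A * U (k + 1) + C * U k"
    and U_0: "U 0 = 0" and U_1: "U 1 = 1"
begin

text \<open>The recurrence at index -1 makes \<open>C\<close> a unit, so that the ring needs no
  division.\<close>

lemma C_mult_U_minus_1: "C * U (- 1) = 1"
  using U_rec[of "- 1"] by (simp add: U_0 U_1)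

text \<open>As functions of \<open>s\<close> both sides solve the recurrence, and they agree at
  \<open>s = 0\<close> and \<open>s = 1\<close>.\<close>

lemma P_add: "P (k + int s) = C * U (int s - 1) * P k + U (int s) * P (k + 1)"
proof (induction s rule: induct_nat_012)
  case 0
  show ?case by (simp add: C_mult_U_minus_1 U_0)
next
  case 1
  show ?case by (simp add: U_0 U_1)
next
  case (ge2 s)
  have "P (k + int (Suc (Suc s))) = A * P (k + int (Suc s)) + C * P (k + int s)"
    using P_rec[of "k + int s"] by (simp add: add_ac)
  also have "\<dots> = C * (A * U (int s) + C * U (int s - 1)) * P k
      + (A * U (int s + 1) + C * U (int s)) * P (k + 1)"
    unfolding ge2 by (simp add: algebra_simps)
  also have "\<dots> = C * U (int s + 1) * P k + U (int s + 2) * P (k + 1)"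
    using U_rec[of "int s - 1"] U_rec[of "int s"] by (simp add: add.commute)
  finally show ?case by (simp add: add_ac)
qed

text \<open>After expanding \<open>P (k + s)\<close> and \<open>P (k + s + 1)\<close> by
  \<open>P_add\<close>, from the bases \<open>k\<close> and \<open>k + 1\<close>, the terms with
  \<open>U (s - 1)\<close> cancel.\<close>

lemma P_cross:
  "P k * P (k + int s + 1) - P (k + int s) * P (k + 1) =
    U (int s) * (P k * P (k + 2) - (P (k + 1))\<^sup>2)"
proof -
  have eq: "P (k + int s + 1) = C * U (int s - 1) * P (k + 1) + U (int s) * P (k + 2)"
    using P_add[of "k + 1" s] by (simp add: add_ac)
  show ?thesis
    unfolding eq P_add by (simp add: algebra_simps power2_eq_square)
qed

text \<open>The factor \<open>- C\<close> is the determinant of the companion matrix of the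
  recurrence.\<close>

lemma Cassini_step:
  "P (k + 1) * P (k + 3) - (P (k + 2))\<^sup>2 = - C * (P k * P (k + 2) - (P (k + 1))\<^sup>2)"
proof -
  have "P (k + 3) = A * P (k + 2) + C * P (k + 1)"
    using P_rec[of "k + 1"] by (simp add: add_ac)
  then show ?thesis
    by (simp add: P_rec algebra_simps power2_eq_square)
qed

text \<open>Lowering both indices by one takes out a factor \<open>- C\<close>; after
  \<open>t\<close> such steps \<open>C * U (- 1) = 1\<close> ends the descent.\<close>

lemma U_cross:
  "C * (U (int t - 1) * U u - U (int t) * U (u - 1)) = (- C) ^ t * U (u - int t)"
proof (induction t arbitrary: u)
  case 0
  show ?case using C_mult_U_minus_1 by (simp add: U_0 mult.assoc[symmetric])
next
  case (Suc t)
  have "U u = A * U (u - 1) + C * U (u - 2)" "U (int t + 1) = A * U (int t) + C * U (int t - 1)"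
    using U_rec[of "u - 2"] U_rec[of "int t - 1"] by (simp_all add: add.commute)
  then have "C * (U (int t) * U u - U (int t + 1) * U (u - 1)) =
      - C * (C * (U (int t - 1) * U (u - 1) - U (int t) * U (u - 1 - 1)))"
    by (simp add: algebra_simps)
  also have "\<dots> = (- C) ^ Suc t * U (u - int (Suc t))"
    unfolding Suc.IH by (simp add: algebra_simps)
  finally show ?case by (simp add: add.commute)
qed

end

section \<open>The polynomial sequences and their Cassini identity\<close>

lemma poly_seq_rec:
  assumes "c \<noteq> 0"
  shows "poly_seq p q r a b c (k + 2) =
    [:b, a:] * poly_seq p q r a b c (k + 1) + [:c:] * poly_seq p q r a b c k"
proof (cases "k \<ge> 0")
  case True
  then show ?thesis
    by (subst poly_seq.simps) (simp add: add.commute)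
next
  case False
  then have "smult c (poly_seq p q r a b c k) =
      smult c (- (smult (1 / c) [:b, a:] * poly_seq p q r a b c (k + 1))
        + smult (1 / c) (poly_seq p q r a b c (k + 2)))"
    by (subst poly_seq.simps) simp
  also have "\<dots> = - ([:b, a:] * poly_seq p q r a b c (k + 1)) + poly_seq p q r a b c (k + 2)"
    using assms by (simp only: smult_add_right smult_minus_right mult_smult_left smult_smult) simp
  finally show ?thesis by simp
qed

lemma recurrence_pair_poly_seq:
  assumes "c \<noteq> 0"
  shows "recurrence_pair (poly_seq p q r a b c) (poly_seq 0 0 1 a b c) [:b, a:] [:c:]"
proof
  show "poly_seq 0 0 1 a b c 0 = 0" "poly_seq 0 0 1 a b c 1 = 1"
    by (simp_all add: poly_seq.simps)
qed (rule poly_seq_rec[OF assms])+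

text \<open>At \<open>k = 0\<close> a direct computation gives minus \<open>Delta\<close>;
  \<open>Cassini_step\<close> carries this upwards, and downwards after cancelling the nonzero
  \<open>- c\<close>.\<close>

lemma poly_seq_Cassini:
  fixes p q r a b c :: real
  assumes "c \<noteq> 0"
  defines "P \<equiv> poly_seq p q r a b c"
  shows "P k * P (k + 2) - (P (k + 1))\<^sup>2 = smult (- ((- c) powi k)) (Delta p q r a b c)"
proof -
  interpret recurrence_pair P "poly_seq 0 0 1 a b c" "[:b, a:]" "[:c:]"
    unfolding P_def by (rule recurrence_pair_poly_seq) fact
  show ?thesis
  proof (induction k rule: int_induct[where k = 0])
    case base
    have "P 0 = [:p:]" "P 1 = [:r, q:]"
      by (simp_all add: P_def poly_seq.simps)
    moreover have "P 2 = [:b, a:] * P 1 + [:c:] * P 0"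
      using P_rec[of 0] by simp
    ultimately show ?case
      by (simp add: Delta_def algebra_simps power2_eq_square)
  next
    case (step1 i)
    have "P (i + 1) * P (i + 1 + 2) - (P (i + 1 + 1))\<^sup>2 =
        - [:c:] * (P i * P (i + 2) - (P (i + 1))\<^sup>2)"
      using Cassini_step[of i] by (simp add: add.assoc)
    then show ?case
      using assms(1) unfolding step1 by (simp add: power_int_add)
  next
    case (step2 i)
    have "smult (- c) (P (i - 1) * P (i - 1 + 2) - (P (i - 1 + 1))\<^sup>2) =
        P i * P (i + 2) - (P (i + 1))\<^sup>2"
      using Cassini_step[of "i - 1"] by (simp add: add.commute)
    also have "\<dots> = smult (- c) (smult (- ((- c) powi (i - 1))) (Delta p q r a b c))"
      unfolding step2 using assms(1) by (simp add: power_int_diff)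
    finally show ?case
      using assms(1) by (metis neg_equal_0_iff_equal smult_cancel)
  qed
qed

section \<open>Rising powers and products over triangles\<close>

lemma rising_power_split:
  assumes "j \<le> N" "N \<le> m"
  shows "rising_power P (k + int j) m = rising_power P (k + int N) (m - N) *
    ((\<Prod>s<j. P (k + int (m + s))) * (\<Prod>s = j..<N. P (k + int s)))"
proof -
  have *: "(\<Prod>s<h. P (k + int (l + s))) = (\<Prod>s = l..<l + h. P (k + int s))" for l h
    using prod.shift_bounds_nat_ivl[of "\<lambda>s. P (k + int s)" 0 l h]
    by (simp add: atLeast0LessThan add.commute)
  have "rising_power P (k + int j) m = (\<Prod>s = j..<j + m. P (k + int s))"
    unfolding *[symmetric] by (simp add: rising_power_def add.assoc)
  \<comment> \<open>The offsets from \<open>j\<close> to \<open>j + m - 1\<close> are cut at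
    \<open>N\<close> and \<open>m\<close>; the middle block is the same for all
    \<open>j\<close>.\<close>
  also have "\<dots> = (\<Prod>s = j..<N. P (k + int s)) * (\<Prod>s = N..<m. P (k + int s)) *
      (\<Prod>s = m..<m + j. P (k + int s))"
    using assms by (simp add: prod.atLeastLessThan_concat add.commute)
  also have "(\<Prod>s = N..<m. P (k + int s)) = rising_power P (k + int N) (m - N)"
    using *[where h = "m - N" and l = N] assms by (simp add: rising_power_def add.assoc)
  also have "(\<Prod>s = m..<m + j. P (k + int s)) = (\<Prod>s<j. P (k + int (m + s)))"
    by (rule *[symmetric])
  finally show ?thesis by (simp only: mult_ac)
qed

text \<open>Exactly \<open>Suc N - i\<close> pairs of indices up to \<open>N\<close> have difference
  \<open>i\<close>.\<close>

lemma prod_triangle_diff: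
  fixes f :: "nat \<Rightarrow> 'a :: comm_monoid_mult"
  shows "(\<Prod>k<Suc N. \<Prod>i<k. f (k - i)) = (\<Prod>i = 1..N. f i ^ (Suc N - i))"
proof (induction N)
  case (Suc N)
  have "(\<Prod>i<Suc N. f (Suc N - i)) = (\<Prod>i = 1..Suc N. f i)"
    by (rule prod.reindex_bij_witness[of _ "\<lambda>i. Suc N - i" "\<lambda>i. Suc N - i"]) auto
  moreover have "(\<Prod>i = 1..N. f i ^ (Suc (Suc N) - i)) = (\<Prod>i = 1..N. f i ^ (Suc N - i)) * (\<Prod>i = 1..N. f i)"
    by (simp add: prod.distrib[symmetric] Suc_diff_le mult.commute)
  ultimately show ?case
    using Suc.IH by (simp add: mult_ac)
qed simp

text \<open>Both sides are d(d-1)(d-2)/2. This merges the exponents of \<open>c\<close> coming from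
  the minors of \<open>P\<close> and of \<open>U\<close>.\<close>

lemma choose_2_mult: "(int d - 2) * int (d choose 2) = 3 * int (d choose 3)"
proof (cases "2 \<le> d")
  case True
  have "(d - 2) * (d choose 2) = 3 * (d choose 3)"
    using binomial_absorb_comp[of d 2] binomial_absorption[of 2 d]
    by (simp add: numeral_3_eq_3 numeral_2_eq_2)
  then have "int (d - 2) * int (d choose 2) = 3 * int (d choose 3)"
    by (metis of_nat_mult of_nat_numeral)
  with True show ?thesis by (simp add: of_nat_diff)
qed (simp add: binomial_eq_0)

lemma prod_triangle_power_int:
  fixes x :: "'a :: field"
  assumes "x \<noteq> 0"
  shows "(\<Prod>k<d. \<Prod>i<k. - (x powi (n + int i))) =
    (- 1) ^ (d choose 2) * x powi (n * int (d choose 2) + int (d choose 3))"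
proof -
  have "(\<Prod>i<k. - (x powi (n + int i))) = (- 1) ^ k * x powi (n * int k + int (k choose 2))" for k
    by (induction k) (use assms in \<open>simp_all add: numeral_2_eq_2 power_int_add algebra_simps\<close>)
  moreover have "(\<Prod>k<d. (- 1) ^ k * x powi (n * int k + int (k choose 2))) =
      (- 1) ^ (d choose 2) * x powi (n * int (d choose 2) + int (d choose 3))"
    by (induction d) (use assms in \<open>simp_all add: numeral_2_eq_2 numeral_3_eq_3
      power_int_add power_add algebra_simps\<close>)
  ultimately show ?thesis by simp
qed

text \<open>The exponent is the sum of t(t+1) over \<open>t < N\<close>.\<close>

lemma prod_triangle_power:
  fixes x :: "'a :: comm_monoid_mult"
  shows "(\<Prod>t<N. \<Prod>s\<le>t. x ^ t) = x ^ (2 * (Suc N choose 3))"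
proof (induction N)
  case (Suc N)
  have "2 * (Suc N choose 2) = N * Suc N"
    by (simp add: choose_two)
  then have "2 * (Suc (Suc N) choose 3) = N * Suc N + 2 * (Suc N choose 3)"
    by (simp add: numeral_3_eq_3 numeral_2_eq_2)
  then show ?case
    using Suc.IH by (simp add: power_add power_mult[symmetric] mult.commute)
qed (simp add: binomial_eq_0)

section \<open>The determinant of rising powers\<close>

theorem theorem5:
  fixes n :: int and m d :: nat and p q r a b c :: real
    and P U :: "int \<Rightarrow> real poly"
  assumes "m \<ge> 1" and "1 \<le> d" and "d \<le> m + 1" and "c \<noteq> 0"
    and "P = poly_seq p q r a b c"
    and "U = poly_seq 0 0 1 a b c"
  shows "det (mat d d (\<lambda>(i, j). rising_power P (n + int i + int j) m)) =
    smult ((- 1) powi (n * int (d choose 2) + int ((d + 1) choose 3))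
           * c powi ((n + int d - 2) * int (d choose 2)))
      (Delta p q r a b c ^ (d choose 2)
       * (\<Prod>i = 1..d - 1. (U (int i) * U (int m + 1 - int i)) ^ (d - i))
       * (\<Prod>i = d - 1..2 * (d - 1). rising_power P (n + int i) (m + 1 - d)))"
proof -
  obtain N where d: "d = Suc N"
    using \<open>1 \<le> d\<close> by (cases d) auto
  have "N \<le> m"
    using assms(3) d by simp
  interpret recurrence_pair P U "[:b, a:]" "[:c:]"
    unfolding assms(5,6) by (rule recurrence_pair_poly_seq) fact
  define \<Delta> where "\<Delta> = Delta p q r a b c"
  define K where "K = d choose 2"
  \<comment> \<open>The coefficients are those of \<open>P_add\<close> at offset \<open>s\<close>
    for \<open>?a\<close>, \<open>?a'\<close> and at offset \<open>m + s\<close> for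
    \<open>?b\<close>, \<open>?b'\<close>.\<close>
  let ?X = "\<lambda>i. P (n + int i)" and ?Y = "\<lambda>i. P (n + int i + 1)"
    and ?a = "\<lambda>s. [:c:] * U (int s - 1)" and ?a' = "\<lambda>s. U (int s)"
    and ?b = "\<lambda>s. [:c:] * U (int (m + s) - 1)" and ?b' = "\<lambda>s. U (int (m + s))"
  let ?F = "\<lambda>i j. (\<Prod>s<j. ?b s * ?X i + ?b' s * ?Y i) * (\<Prod>s = j..<N. ?a s * ?X i + ?a' s * ?Y i)"
  let ?\<rho> = "\<lambda>i. rising_power P (n + int i + int N) (m - N)"

  have cross_P: "?X i * ?Y k - ?X k * ?Y i = [:- ((- c) powi (n + int i)):] * (\<Delta> * U (int (k - i)))"
    if "i < k" for i k
  proof -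
    have "n + int i + int (k - i) = n + int k"
      using that by simp
    then have "?X i * ?Y k - ?X k * ?Y i =
        U (int (k - i)) * (?X i * P (n + int i + 2) - (?Y i)\<^sup>2)"
      using P_cross[of "n + int i" "k - i"] by simp
    also have "\<dots> = [:- ((- c) powi (n + int i)):] * (\<Delta> * U (int (k - i)))"
      unfolding assms(5) \<Delta>_def by (subst poly_seq_Cassini[OF \<open>c \<noteq> 0\<close>]) (simp add: mult.commute)
    finally show ?thesis .
  qed
  have prod_P: "(\<Prod>k<d. \<Prod>i<k. ?X i * ?Y k - ?X k * ?Y i) =
      [:(- 1) ^ K * (- c) powi (n * int K + int (d choose 3)):] *
      (\<Delta> ^ K * (\<Prod>i = 1..N. U (int i) ^ (d - i)))"
  proof -
    have "(\<Prod>k<d. \<Prod>i<k. ?X i * ?Y k - ?X k * ?Y i) =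
        (\<Prod>k<d. \<Prod>i<k. [:- ((- c) powi (n + int i)):]) *
        ((\<Prod>k<d. \<Prod>i<k. \<Delta>) * (\<Prod>k<d. \<Prod>i<k. U (int (k - i))))"
      unfolding prod.distrib[symmetric] by (intro prod.cong refl cross_P) simp
    also have "(\<Prod>k<d. \<Prod>i<k. [:- ((- c) powi (n + int i)):]) =
        [:\<Prod>k<d. \<Prod>i<k. - ((- c) powi (n + int i)):]"
      by (simp only: prod_to_poly)
    also have "(\<Prod>k<d. \<Prod>i<k. - ((- c) powi (n + int i))) =
        (- 1) ^ K * (- c) powi (n * int K + int (d choose 3))"
      unfolding K_def by (rule prod_triangle_power_int) (use \<open>c \<noteq> 0\<close> in simp)
    also have "(\<Prod>k<d. \<Prod>i<k. \<Delta>) = \<Delta> ^ K"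
      unfolding K_def by (induction d) (simp_all add: numeral_2_eq_2 power_add mult.commute)
    also have "(\<Prod>k<d. \<Prod>i<k. U (int (k - i))) = (\<Prod>i = 1..N. U (int i) ^ (d - i))"
      unfolding d by (rule prod_triangle_diff)
    finally show ?thesis .
  qed

  have cross_U: "?a t * ?b' s - ?a' t * ?b s = [:(- c) ^ t:] * U (int m + int s - int t)" for s t
  proof -
    have "[:(- c) ^ t:] = (- [:c:]) ^ t"
      by (simp add: poly_const_pow)
    then show ?thesis
      using U_cross[of t "int m + int s"] by (simp add: algebra_simps smult_diff_right)
  qed
  have prod_U: "(\<Prod>t<N. \<Prod>s\<le>t. ?a t * ?b' s - ?a' t * ?b s) =
      [:(- c) ^ (2 * (d choose 3)):] * (\<Prod>i = 1..N. U (int m + 1 - int i) ^ (d - i))"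
  proof -
    \<comment> \<open>Substitute \<open>k = t + 1\<close> and \<open>i = s\<close>; the new row
      \<open>k = 0\<close> is an empty product.\<close>
    have "(\<Prod>t<N. \<Prod>s\<le>t. U (int m + int s - int t)) =
        (\<Prod>k<d. \<Prod>i<k. U (int m + 1 - int (k - i)))"
      unfolding d prod.lessThan_Suc_shift[of _ N]
      by (simp add: lessThan_Suc_atMost of_nat_diff algebra_simps cong: prod.cong_simp)
    also have "\<dots> = (\<Prod>i = 1..N. U (int m + 1 - int i) ^ (d - i))"
      unfolding d by (rule prod_triangle_diff)
    finally show ?thesis
      unfolding cross_U prod.distrib prod_to_poly d prod_triangle_power by simp
  qed

  have prod_\<rho>: "(\<Prod>i<d. ?\<rho> i) = (\<Prod>i = d - 1..2 * (d - 1). rising_power P (n + int i) (m + 1 - d))"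
    by (rule prod.reindex_bij_witness[of _ "\<lambda>i. i - N" "\<lambda>i. i + N"]) (auto simp: d add.assoc)

  \<comment> \<open>The signs combine by Pascal's rule, the last power being even; the powers of
    \<open>c\<close> combine by \<open>choose_2_mult\<close>.\<close>
  have scalar: "(- 1) ^ K * (- c) powi (n * int K + int (d choose 3)) * (- c) ^ (2 * (d choose 3)) =
      (- 1) powi (n * int K + int ((d + 1) choose 3)) * c powi ((n + int d - 2) * int K)"
  proof -
    have sgn: "(- c) powi k = (- 1) powi k * c powi k" for k
      using power_int_mult_distrib[of "- 1" c k] by simp
    have "int ((d + 1) choose 3) = int K + int (d choose 3)"
      by (simp add: K_def numeral_3_eq_3 numeral_2_eq_2)
    moreover have "(n + int d - 2) * int K = n * int K + int (d choose 3) + int (2 * (d choose 3))"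
      using choose_2_mult[of d] by (simp add: K_def algebra_simps)
    moreover have "(- c) ^ (2 * (d choose 3)) = c ^ (2 * (d choose 3))"
      by simp
    ultimately show ?thesis
      using \<open>c \<noteq> 0\<close> by (simp only: sgn) (simp add: power_int_add del: of_nat_mult)
  qed

  \<comment> \<open>The factor 1 is a trivial column scaling that fits the shape of
    \<open>det_scale_rows_cols\<close>.\<close>
  have "mat d d (\<lambda>(i, j). rising_power P (n + int i + int j) m) =
      mat d d (\<lambda>(i, j). ?\<rho> i * 1 * ?F i j)"
  proof (intro cong_mat refl; clarify)
    fix i j assume "j < d"
    have "P (n + int i + int s) = ?a s * ?X i + ?a' s * ?Y i" for s
      by (rule P_add)
    moreover have "P (n + int i + int (m + s)) = ?b s * ?X i + ?b' s * ?Y i" for s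
      by (rule P_add)
    ultimately show "rising_power P (n + int i + int j) m = ?\<rho> i * 1 * ?F i j"
      using rising_power_split[of j N m P "n + int i"] \<open>j < d\<close> \<open>N \<le> m\<close> d by simp
  qed
  then have "det (mat d d (\<lambda>(i, j). rising_power P (n + int i + int j) m)) =
      (\<Prod>i<d. ?\<rho> i) * det (mat d d (\<lambda>(i, j). ?F i j))"
    by (simp only: det_scale_rows_cols) simp
  also have "det (mat d d (\<lambda>(i, j). ?F i j)) =
      (\<Prod>k<d. \<Prod>i<k. ?X i * ?Y k - ?X k * ?Y i) * (\<Prod>t<N. \<Prod>s\<le>t. ?a t * ?b' s - ?a' t * ?b s)"
    unfolding d by (rule det_linear_forms)
  also have "(\<Prod>i<d. ?\<rho> i) * \<dots> =
      [:(- 1) ^ K * (- c) powi (n * int K + int (d choose 3)) * (- c) ^ (2 * (d choose 3)):] *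
      (\<Delta> ^ K * (\<Prod>i = 1..N. (U (int i) * U (int m + 1 - int i)) ^ (d - i)) * (\<Prod>i<d. ?\<rho> i))"
    unfolding prod_P prod_U by (simp add: power_mult_distrib prod.distrib mult_ac)
  finally show ?thesis
    unfolding scalar prod_\<rho> by (simp add: d K_def \<Delta>_def)
qed

end
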